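(* Let $G$ be an Eulerian graph of genus $g$ with $m$ edges, and let $T$ be a spanning tree of $G$. Then $$\operatorname{ec}(G)=\frac{1}{m\cdot 2^g}\sum_{\gamma\in M_2(E^c(T))}(-1)^{\sigma(\gamma)}\operatorname{trace}\left(W_{1,\gamma}^m\right)=\frac{1}{m\cdot 2^g}\sum_{\gamma\in M_2(E^c(T))}(-1)^{\sigma(\gamma)}\operatorname{trace}\left(A_\gamma^m\right).$$
   Context: A graph is a connected finite graph, loops and multiple edges allowed, with vertices $v_1,\dots,v_n$ and edges $e_1,\dots,e_m$; its genus is $g=m-n+1$. Each edge gives two mutually inverse oriented edges; for an oriented edge $\mathbf e$, $\mathbf e(0),\mathbf e(1)$ are its initial and terminal vertices and $\mathbf e^{-1}(0)=\mathbf e(1)$, $\mathbf e^{-1}(1)=\mathbf e(0)$. Fix an orientation (a choice of one "positively oriented" oriented edge $\mathbf e_k$ for each edge $e_k$); $\mathbf E(G)$ denotes the set of all $2m$ oriented edges. A closed walk of length $l$ is a sequence $\mathbf a_1\cdots\mathbf a_l$ of oriented edges with $\mathbf a_{i+1}(0)=\mathbf a_i(1)$ and $\mathbf a_l(1)=\mathbf a_1(0)$. An Eulerian circuit is a closed walk traversing every edge of $G$ exactly once (in one of its two directions); $G$ is Eulerian if it has one. $\operatorname{ec}(G)$ is the number of Eulerian cycles, i.e. equivalence classes of Eulerian circuits under cyclic rotation $\mathbf a_1\cdots\mathbf a_l\sim\mathbf a_2\cdots\mathbf a_l\mathbf a_1$ (a circuit and its reversal are counted as different). $C_1(G,\mathbb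 Z/2\mathbb Z)$ is the $\mathbb Z/2\mathbb Z$-vector space with basis the edges; $E^c(T)$ is the set of edges not in $T$ and $M_2(E^c(T))$ is the subspace of elements $\gamma=\sum_{e\in E^c(T)}c_e\, e$, $c_e\in\mathbb Z/2\mathbb Z$; $\sigma(\gamma)=\sum_{e\in E^c(T)}c_e$. For $\gamma\in M_2(E^c(T))$ and an oriented edge $\mathbf e$ with underlying edge $e$, put $\chi_\gamma(\mathbf e)=(-1)^{c_e}$ (with $c_e=0$ for $e\in T$). The twisted vertex adjacency matrix $A_\gamma$ is the $n\times n$ matrix whose $(i,j)$ entry is $\sum\chi_\gamma(\mathbf e)$ over oriented edges $\mathbf e$ with $\mathbf e(0)=v_i$, $\mathbf e(1)=v_j$. An oriented edge $\mathbf e$ feeds into $\mathbf e'$ if $\mathbf e'\neq\mathbf e^{-1}$ and $\mathbf e(1)=\mathbf e'(0)$. The twisted edge adjacency matrix $W_{1,\gamma}$ is the $2m\times 2m$ matrix indexed by $\mathbf E(G)$ whose $(\mathbf e,\mathbf e')$ entry is $\chi_\gamma(\mathbf e)$ if $\mathbf e$ feeds into $\mathbf e'$ and $0$ otherwise. *)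

theory Defs
  imports
    "HOL-Library.Z2"
    "Jordan_Normal_Form.Matrix"
    "Graph_Theory.Digraph_Component"
begin

text \<open>
  A graph (undirected, loops and multiple edges allowed) together with a fixed orientation
  is a \<^typ>\<open>('v,'e) pre_digraph\<close>: its arcs are the edges of the graph, each pointing in its
  positive direction. Everything below refers to the underlying undirected graph through
  the digraph of its oriented edges: the oriented edge \<open>(e, True)\<close> is \<open>e\<close> taken positively,
  \<open>(e, False)\<close> is its inverse. A loop also gives two different oriented edges.
\<close>

definition oriented :: "('v,'e) pre_digraph \<Rightarrow> ('v, 'e \<times> bool) pre_digraph" where
  "oriented G = \<lparr> verts = verts G, arcs = arcs G \<times> UNIV,
     tail = (\<lambda>(e, b). if b then tail G e else head G e),
     head = (\<lambda>(e, b). if b then head G e else tail G e) \<rparr>"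

lemma wf_digraph_oriented: "wf_digraph G \<Longrightarrow> wf_digraph (oriented G)"
  by (auto simp: wf_digraph_def oriented_def split: if_splits)

fun inv_edge :: "'e \<times> bool \<Rightarrow> 'e \<times> bool" where
  "inv_edge (e, b) = (e, \<not> b)"

text \<open>
  Natural number subtraction does not truncate here for connected \<open>G\<close>,
  as then \<open>card (verts G) \<le> card (arcs G) + 1\<close>.
\<close>
definition genus :: "('v,'e) pre_digraph \<Rightarrow> nat" where
  "genus G = card (arcs G) + 1 - card (verts G)"

text \<open>
  The library's \<^const>\<open>Digraph_Component.connected\<close> is connectedness of the underlying
  undirected graph, but its \<^const>\<open>forest\<close> excludes only directed cycles. Here a cycle may run
  through edges in either direction; it may not use an edge twice.
\<close>
definition undirected_cycle :: "('v,'e) pre_digraph \<Rightarrow> ('e \<times> bool) list \<Rightarrow> bool" where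
  "undirected_cycle G p \<longleftrightarrow> pre_digraph.cycle (oriented G) p \<and> distinct (map fst p)"

definition undirected_tree :: "('v,'e) pre_digraph \<Rightarrow> bool" where
  "undirected_tree G \<longleftrightarrow> Digraph_Component.connected G \<and> (\<nexists>p. undirected_cycle G p)"

definition undirected_spanning_tree :: "('v,'e) pre_digraph \<Rightarrow> ('v,'e) pre_digraph \<Rightarrow> bool" where
  "undirected_spanning_tree T G \<longleftrightarrow> undirected_tree T \<and> spanning T G"

text \<open>
  Closed walks (\<^const>\<open>wf_digraph.closed_w\<close>) have length at least 1, so the graph consisting
  of a single vertex and no edges is not Eulerian.
\<close>
definition eulerian_circuit :: "('v,'e) pre_digraph \<Rightarrow> ('e \<times> bool) list \<Rightarrow> bool" where
  "eulerian_circuit G p \<longleftrightarrow>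
     wf_digraph.closed_w (oriented G) p \<and> (\<forall>e\<in>arcs G. count_list (map fst p) e = 1)"

definition eulerian :: "('v,'e) pre_digraph \<Rightarrow> bool" where
  "eulerian G \<longleftrightarrow> (\<exists>p. eulerian_circuit G p)"

definition rotation_rel :: "('v,'e) pre_digraph \<Rightarrow> (('e \<times> bool) list \<times> ('e \<times> bool) list) set" where
  "rotation_rel G =
     {(p, q). eulerian_circuit G p \<and> eulerian_circuit G q \<and> (\<exists>k. q = rotate k p)}"

definition ec :: "('v,'e) pre_digraph \<Rightarrow> nat" where
  "ec G = card ({p. eulerian_circuit G p} // rotation_rel G)"

text \<open>A chain is given by its coefficients, extended by 0 to all of the type \<^typ>\<open>'e\<close>.\<close>

definition C1 :: "('v,'e) pre_digraph \<Rightarrow> ('e \<Rightarrow> bit) set" where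
  "C1 G = {\<gamma>. \<forall>e. e \<notin> arcs G \<longrightarrow> \<gamma> e = 0}"

definition co_edges :: "('v,'e) pre_digraph \<Rightarrow> ('v,'e) pre_digraph \<Rightarrow> 'e set" where
  "co_edges G T = arcs G - arcs T"

definition M2 :: "('v,'e) pre_digraph \<Rightarrow> ('v,'e) pre_digraph \<Rightarrow> ('e \<Rightarrow> bit) set" where
  "M2 G T = {\<gamma> \<in> C1 G. \<forall>e. e \<notin> co_edges G T \<longrightarrow> \<gamma> e = 0}"

definition \<sigma> :: "('v,'e) pre_digraph \<Rightarrow> ('v,'e) pre_digraph \<Rightarrow> ('e \<Rightarrow> bit) \<Rightarrow> bit" where
  "\<sigma> G T \<gamma> = (\<Sum>e\<in>co_edges G T. \<gamma> e)"

text \<open>The power of \<open>-1\<close> with exponent in \<open>\<int>/2\<int>\<close>.\<close>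
definition sign_bit :: "bit \<Rightarrow> real" where
  "sign_bit c = (if c = 0 then 1 else - 1)"

definition \<chi> :: "('e \<Rightarrow> bit) \<Rightarrow> 'e \<times> bool \<Rightarrow> real" where
  "\<chi> \<gamma> a = sign_bit (\<gamma> (fst a))"

definition feeds_into :: "('v,'e) pre_digraph \<Rightarrow> 'e \<times> bool \<Rightarrow> 'e \<times> bool \<Rightarrow> bool" where
  "feeds_into G a a' \<longleftrightarrow> a' \<noteq> inv_edge a \<and> head (oriented G) a = tail (oriented G) a'"

text \<open>
  Rows and columns are numbered by a list: \<open>vs\<close> enumerates the vertices,
  \<open>as\<close> the oriented edges.
\<close>

definition twisted_vertex_adj ::
    "('v,'e) pre_digraph \<Rightarrow> 'v list \<Rightarrow> ('e \<Rightarrow> bit) \<Rightarrow> real mat" where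
  "twisted_vertex_adj G vs \<gamma> = mat (length vs) (length vs) (\<lambda>(i, j).
     \<Sum>a | a \<in> arcs (oriented G) \<and> tail (oriented G) a = vs ! i \<and> head (oriented G) a = vs ! j.
       \<chi> \<gamma> a)"

definition twisted_edge_adj ::
    "('v,'e) pre_digraph \<Rightarrow> ('e \<times> bool) list \<Rightarrow> ('e \<Rightarrow> bit) \<Rightarrow> real mat" where
  "twisted_edge_adj G as \<gamma> = mat (length as) (length as) (\<lambda>(i, j).
     if feeds_into G (as ! i) (as ! j) then \<chi> \<gamma> (as ! i) else 0)"

definition mat_trace :: "'a :: comm_monoid_add mat \<Rightarrow> 'a" where
  "mat_trace A = (\<Sum>i<dim_row A. A $$ (i, i))"

end

theory Submission
  imports Defs
begin

text \<open>
  The traces of the \<open>m\<close>-th powers are sums over closed walks of length \<open>m\<close> of the product of the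
  signs of their edges. Summing over \<open>\<gamma>\<close> with the sign of \<open>\<sigma> \<gamma>\<close> is a character sum that kills every
  walk except those using each edge outside \<open>T\<close> an odd number of times, which get weight \<open>2 ^ g\<close>.
  The parity vector of a closed walk is a cycle modulo 2, and so is the all-ones vector because \<open>G\<close> is
  Eulerian. For a surviving walk the two agree outside \<open>T\<close>, so their difference is a cycle supported
  on a tree and vanishes. Hence the walk uses each of the \<open>m\<close> edges an odd number of times in
  \<open>m\<close> steps, that is, exactly once. Finally, each Eulerian cycle consists of \<open>m\<close> distinct circuits.

  That the complement of \<open>T\<close> has \<open>g\<close> edges is obtained by injecting sets of edges into sets of
  vertices avoiding a root by the boundary (acyclicity), and conversely by the coboundary
  (connectedness).
\<close>

subsection \<open>Mod 2 boundaries and trees\<close>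

text \<open>A loop counts twice at its vertex, hence contributes nothing modulo 2.\<close>

definition boundary :: "('v,'e) pre_digraph \<Rightarrow> 'e set \<Rightarrow> 'v \<Rightarrow> bit" where
  "boundary G F v = (\<Sum>e\<in>F. of_bool (tail G e = v) + of_bool (head G e = v))"

lemma bit_add_self [simp]: "x + x = (0::bit)"
  by (cases x) simp_all

lemma boundary_sym_diff:
  assumes "finite A" "finite B"
  shows "boundary G ((A - B) \<union> (B - A)) v = boundary G A v + boundary G B v"
proof -
  have A: "boundary G A v = boundary G (A - B) v + boundary G (A \<inter> B) v"
    unfolding boundary_def sum.Int_Diff[OF assms(1), of _ B] by (rule add.commute)
  have B: "boundary G B v = boundary G (B - A) v + boundary G (A \<inter> B) v"
    unfolding boundary_def sum.Int_Diff[OF assms(2), of _ A] by (simp only: add.commute Int_commute)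
  have "boundary G ((A - B) \<union> (B - A)) v = boundary G (A - B) v + boundary G (B - A) v"
    unfolding boundary_def using assms by (intro sum.union_disjoint) auto
  also have "\<dots> = boundary G (A - B) v + boundary G (B - A) v
      + (boundary G (A \<inter> B) v + boundary G (A \<inter> B) v)"
    by simp
  finally show ?thesis unfolding A B by (simp only: ac_simps)
qed

text \<open>Each edge contributes once through its tail and once through its head, which cancel
  modulo 2.\<close>

lemma sum_boundary:
  assumes "wf_digraph G" "finite (verts G)" "F \<subseteq> arcs G"
  shows "(\<Sum>v\<in>verts G. boundary G F v) = 0"
proof -
  interpret wf_digraph G by fact
  have "(\<Sum>v\<in>verts G. boundary G F v)
      = (\<Sum>e\<in>F. \<Sum>v\<in>verts G. of_bool (tail G e = v) + of_bool (head G e = v))"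
    unfolding boundary_def by (rule sum.swap)
  also have "\<dots> = (\<Sum>e\<in>F. 0)"
  proof (rule sum.cong)
    fix e assume "e \<in> F"
    then have "tail G e \<in> verts G" "head G e \<in> verts G"
      using assms(3) by auto
    moreover have "(\<Sum>v\<in>verts G. of_bool (x = v)) = (1::bit)" if "x \<in> verts G" for x
      using that assms(2) by (simp add: of_bool_def)
    ultimately show "(\<Sum>v\<in>verts G. of_bool (tail G e = v) + of_bool (head G e = v)) = (0::bit)"
      by (simp only: sum.distrib bit_add_self)
  qed simp
  finally show ?thesis by simp
qed

lemma oriented_simps [simp]:
  "verts (oriented G) = verts G"
  "arcs (oriented G) = arcs G \<times> UNIV"
  "tail (oriented G) (e, b) = (if b then tail G e else head G e)"
  "head (oriented G) (e, b) = (if b then head G e else tail G e)"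
  by (simp_all add: oriented_def)

text \<open>Adding an edge to a walk toggles it in the set of edges of odd multiplicity, so the edge
  boundaries telescope to the two ends. For a closed walk the result is zero.\<close>

lemma boundary_odd_count:
  assumes "wf_digraph G" "pre_digraph.awalk (oriented G) u p v"
  shows "boundary G {e. odd (count_list (map fst p) e)} x = of_bool (u = x) + of_bool (v = x)"
  using assms(2)
proof (induction p arbitrary: u)
  interpret O: wf_digraph "oriented G" by (rule wf_digraph_oriented) fact
  {
    case Nil
    then show ?case by (simp add: O.awalk_Nil_iff boundary_def)
  next
    case (Cons a p)
    obtain e b where a: "a = (e, b)" by (cases a)
    let ?F = "{f. odd (count_list (map fst p) f)}"
    have "finite ?F"
      by (rule finite_subset[of _ "set (map fst p)"]) (auto intro: ccontr simp: count_list_0_iff)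
    moreover have "{f. odd (count_list (map fst (a # p)) f)} = ({e} - ?F) \<union> (?F - {e})"
      by (auto simp: a)
    ultimately have "boundary G {f. odd (count_list (map fst (a # p)) f)} x
        = boundary G {e} x + boundary G ?F x"
      by (simp only: boundary_sym_diff finite.intros)
    also have "boundary G ?F x = of_bool (head (oriented G) a = x) + of_bool (v = x)"
      using Cons by (simp add: O.awalk_Cons_iff)
    also have "boundary G {e} x = of_bool (u = x) + of_bool (head (oriented G) a = x)"
      using Cons.prems by (auto simp: O.awalk_Cons_iff a boundary_def add.commute)
    finally show ?case by (cases "head (oriented G) a = x") (simp_all flip: add.assoc)
  }
qed

lemma odd_count_distinct:
  assumes "distinct xs"
  shows "{e. odd (count_list xs e)} = set xs"
  using assms by (induction xs) auto

text \<open>If a vertex repeats, a contiguous piece of the walk is a shorter closed walk, whose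
  \<open>f\<close>-values are still distinct. With \<open>f = fst\<close> a closed trail yields an
  undirected cycle.\<close>

lemma (in wf_digraph) closed_w_imp_cycle_distinct_map:
  assumes "closed_w p" "distinct (map f p)"
  shows "\<exists>q. cycle q \<and> distinct (map f q)"
  using assms
proof (induction "length p" arbitrary: p rule: less_induct)
  case less
  then obtain u where u: "awalk u p u" "p \<noteq> []" by (auto simp: closed_w_def)
  show ?case
  proof (cases "distinct (tl (awalk_verts u p))")
    case True
    with less.prems u show ?thesis by (auto simp: cycle_def)
  next
    case False
    obtain e es where p: "p = e # es" using u by (cases p) auto
    with u False have *: "awalk (head G e) es u" "\<not> distinct (awalk_verts (head G e) es)"
      by (auto simp: awalk_Cons_iff)
    obtain q r s where es: "es = q @ r @ s" "closed_w r"
      using awalk_not_distinct_decomp[OF *] by (auto simp: closed_w_def)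
    show ?thesis using less.hyps[of r] less.prems(2) es p by simp
  qed
qed

text \<open>A longest trail in \<open>F\<close> uses up all edges of \<open>F\<close> at its end, so by evenness it is closed.\<close>
lemma even_acyclic_empty:
  assumes wf: "wf_digraph G" and acyc: "\<nexists>p. undirected_cycle G p"
    and F: "finite F" "F \<subseteq> arcs G" and even: "\<And>v. boundary G F v = 0"
  shows "F = {}"
proof (rule ccontr)
  interpret wf_digraph G by fact
  interpret O: wf_digraph "oriented G" by (rule wf_digraph_oriented) fact
  assume "F \<noteq> {}"
  then obtain e where e: "e \<in> F" by blast
  define u where "u = tail G e"
  define P where "P p \<longleftrightarrow> (\<exists>v. O.awalk u p v) \<and> distinct (map fst p) \<and> fst ` set p \<subseteq> F" for p
  have "P [(e, True)]"
    using e F by (auto simp: P_def O.awalk_simps u_def)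
  moreover have bound: "length p \<le> card F" if "P p" for p
  proof -
    have "length p = card (fst ` set p)"
      using that distinct_card[of "map fst p"] by (simp add: P_def)
    then show ?thesis using that F by (simp add: P_def card_mono)
  qed
  ultimately obtain p where p: "P p" and max: "\<And>q. P q \<Longrightarrow> length q \<le> length p"
    using ex_has_greatest_nat[of P "[(e, True)]" length "Suc (card F)"] by (auto simp: less_Suc_eq_le)
  have "p \<noteq> []" using max[OF \<open>P [(e, True)]\<close>] by auto
  from p obtain v where v: "O.awalk u p v" and dist: "distinct (map fst p)"
    and sub: "fst ` set p \<subseteq> F" by (auto simp: P_def)
  have at_end: "f \<in> fst ` set p" if f: "f \<in> F" "tail G f = v \<or> head G f = v" for f
  proof (rule ccontr)
    assume nin: "f \<notin> fst ` set p"
    \<comment> \<open>\<open>b\<close> is the direction in which \<open>f\<close> leaves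
      \<open>v\<close>, so that \<open>f\<close> prolongs the trail.\<close>
    define b where "b \<longleftrightarrow> tail G f = v"
    have "O.awalk v [(f, b)] (head (oriented G) (f, b))"
      using f F by (auto simp: O.awalk_simps b_def)
    then have "O.awalk u (p @ [(f, b)]) (head (oriented G) (f, b))"
      by (rule O.awalk_appendI[OF v])
    then have "P (p @ [(f, b)])" using nin dist sub f by (auto simp: P_def)
    from max[OF this] show False by simp
  qed
  \<comment> \<open>Edges of \<open>F\<close> off the trail miss \<open>v\<close>, so at
    \<open>v\<close> the boundary of \<open>F\<close> is that of the trail, which is 1 unless the
    trail is closed.\<close>
  have "boundary G F v = boundary G (set (map fst p)) v"
    unfolding boundary_def using F sub at_end by (intro sum.mono_neutral_right) auto
  also have "\<dots> = of_bool (u = v) + 1"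
    using boundary_odd_count[OF wf v, of v] by (simp only: odd_count_distinct[OF dist]) simp
  finally have "u = v" using even by (auto split: if_splits)
  then have "O.closed_w p" using v \<open>p \<noteq> []\<close> by (auto simp: O.closed_w_def)
  from O.closed_w_imp_cycle_distinct_map[OF this dist] acyc
  show False by (auto simp: undirected_cycle_def)
qed

section \<open>Counting the edges of a tree and of its complement\<close>

text \<open>Two edge sets with the same image under \<open>\<phi>\<close> differ by a set with zero
  boundary, which is empty by acyclicity. Comparing power sets then bounds the number of
  edges.\<close>

lemma acyclic_card_le:
  assumes "fin_digraph G" "\<nexists>p. undirected_cycle G p" "r \<in> verts G"
  shows "card (arcs G) + 1 \<le> card (verts G)"
proof -
  interpret fin_digraph G by fact
  define \<phi> where "\<phi> F = {v \<in> verts G - {r}. boundary G F v = 1}" for F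
  have "inj_on \<phi> (Pow (arcs G))"
  proof (rule inj_onI)
    fix A B assume AB: "A \<in> Pow (arcs G)" "B \<in> Pow (arcs G)" "\<phi> A = \<phi> B"
    then have fin: "finite A" "finite B" by (auto intro: finite_subset)
    define D where "D = (A - B) \<union> (B - A)"
    have D: "finite D" "D \<subseteq> arcs G" using AB fin by (auto simp: D_def)
    have off: "boundary G D v = 0" if "v \<noteq> r" for v
    proof (cases "v \<in> verts G")
      case True
      then have "boundary G A v = 1 \<longleftrightarrow> boundary G B v = 1"
        using AB(3) that by (auto simp: \<phi>_def set_eq_iff)
      then show ?thesis
        unfolding D_def boundary_sym_diff[OF fin]
        by (cases "boundary G A v"; cases "boundary G B v") auto
    next
      case False
      then show ?thesis
        using D(2) unfolding boundary_def by (intro sum.neutral) auto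
    qed
    \<comment> \<open>Boundary values sum to zero, so the one remaining value, at \<open>r\<close>,
      vanishes too.\<close>
    have "(\<Sum>v\<in>verts G. boundary G D v) = boundary G D r"
      using off assms(3) by (simp add: sum.remove[of _ r])
    then have "boundary G D r = 0"
      using sum_boundary[of G D] D wf_digraph by simp
    with off have "\<And>v. boundary G D v = 0" by (metis)
    then have "D = {}" using even_acyclic_empty D assms(2) wf_digraph by blast
    then show "A = B" by (auto simp: D_def)
  qed
  moreover have "\<phi> ` Pow (arcs G) \<subseteq> Pow (verts G - {r})" by (auto simp: \<phi>_def)
  ultimately have "card (Pow (arcs G)) \<le> card (Pow (verts G - {r}))"
    by (rule card_inj_on_le) simp
  then have "card (arcs G) \<le> card (verts G - {r})" by (simp add: card_Pow)
  moreover have "card (verts G) > 0" using assms(3) by (auto simp: card_gt_0_iff)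
  ultimately show ?thesis using assms(3) by simp
qed

lemma connected_const:
  assumes "Digraph_Component.connected G" "u \<in> verts G" "v \<in> verts G"
    and "\<And>e. e \<in> arcs G \<Longrightarrow> f (tail G e) = f (head G e)"
  shows "f u = f v"
proof -
  have "(u, v) \<in> rtrancl_on (verts G) ((arcs_ends G)\<^sup>s)"
    using assms(1-3) by (simp add: connected_conv)
  then show ?thesis
    by induction (use assms(4) in \<open>auto simp: symcl_def arcs_ends_conv\<close>)
qed

text \<open>\<open>\<delta> S\<close> is the cut of \<open>S\<close>. A set and its complement have
  the same cut; excluding \<open>r\<close> leaves one of the two.\<close>

lemma connected_card_le:
  assumes "fin_digraph G" "Digraph_Component.connected G"
  shows "card (verts G) \<le> card (arcs G) + 1"
proof -
  interpret fin_digraph G by fact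
  obtain r where r: "r \<in> verts G" using assms(2) by (auto simp: connected_conv)
  define \<delta> where "\<delta> S = {e \<in> arcs G. (tail G e \<in> S) \<noteq> (head G e \<in> S)}" for S
  have "inj_on \<delta> (Pow (verts G - {r}))"
  proof (rule inj_onI)
    fix A B assume AB: "A \<in> Pow (verts G - {r})" "B \<in> Pow (verts G - {r})" "\<delta> A = \<delta> B"
    \<comment> \<open>Equal cuts mean that membership in \<open>A\<close> and in \<open>B\<close>
      changes across the same edges, so whether they agree is constant on \<open>G\<close>. They
      agree at \<open>r\<close>, which is in neither.\<close>
    have "(v \<in> A \<longleftrightarrow> v \<in> B) = (r \<in> A \<longleftrightarrow> r \<in> B)" if "v \<in> verts G" for v
      using AB(3) by (intro connected_const[OF assms(2) that r, of "\<lambda>v. v \<in> A \<longleftrightarrow> v \<in> B"])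
        (auto simp: \<delta>_def set_eq_iff)
    then show "A = B" using AB by blast
  qed
  moreover have "\<delta> ` Pow (verts G - {r}) \<subseteq> Pow (arcs G)" by (auto simp: \<delta>_def)
  ultimately have "card (Pow (verts G - {r})) \<le> card (Pow (arcs G))"
    by (rule card_inj_on_le) simp
  then show ?thesis using r by (simp add: card_Pow)
qed

lemma undirected_tree_card:
  assumes "fin_digraph G" "undirected_tree G"
  shows "card (arcs G) + 1 = card (verts G)"
  using assms acyclic_card_le[of G] connected_card_le[of G]
  by (auto simp: undirected_tree_def connected_conv intro: antisym)

lemma card_co_edges:
  assumes "fin_digraph G" "undirected_spanning_tree T G"
  shows "card (co_edges G T) = genus G"
proof -
  interpret fin_digraph G by fact
  have sub: "arcs T \<subseteq> arcs G" "verts T = verts G" "wf_digraph T"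
    using assms(2) by (auto simp: undirected_spanning_tree_def spanning_def subgraph_def)
  then have "fin_digraph T"
    by (auto simp: fin_digraph_def fin_digraph_axioms_def intro: finite_subset)
  then show ?thesis
    using undirected_tree_card[of T] assms(2) sub card_mono[OF finite_arcs sub(1)]
    by (simp add: co_edges_def genus_def card_Diff_subset finite_subset undirected_spanning_tree_def)
qed

subsection \<open>Eulerian circuits and rotation\<close>

text \<open>The multiplicities sum to the length, so the length equals the number of underlying
  edges, and a list as long as its set is distinct.\<close>

lemma eulerian_circuit_length_distinct:
  assumes "fin_digraph G" "eulerian_circuit G p"
  shows "length p = card (arcs G)" "distinct (map fst p)" "set (map fst p) = arcs G"
proof -
  interpret fin_digraph G by fact
  interpret O: wf_digraph "oriented G" by (rule wf_digraph_oriented) (rule wf_digraph)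
  have sub: "set (map fst p) \<subseteq> arcs G"
    using assms(2) by (auto simp: eulerian_circuit_def O.closed_w_def O.awalk_def)
  have one: "count_list (map fst p) e = 1" if "e \<in> arcs G" for e
    using assms(2) that by (simp add: eulerian_circuit_def)
  show 1: "length p = card (arcs G)"
    using sum_count_set[OF sub finite_arcs] one by simp
  have "e \<in> set (map fst p)" if "e \<in> arcs G" for e
    using one[OF that] by (metis count_list_0_iff zero_neq_one)
  then show 2: "set (map fst p) = arcs G" using sub by blast
  show "distinct (map fst p)"
    using 1 unfolding 2[symmetric] by (intro card_distinct) simp
qed

lemma (in wf_digraph) closed_w_rotate:
  assumes "closed_w p"
  shows "closed_w (rotate k p)"
proof (induction k)
  case 0
  then show ?case using assms by simp
next
  case (Suc k)
  then obtain a q where q: "rotate k p = a # q" "awalk (tail G a) (a # q) (tail G a)"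
    by (cases "rotate k p") (auto simp: closed_w_def awalk_Cons_iff)
  \<comment> \<open>Moving the first edge to the end moves the base point to the head of that
    edge.\<close>
  then have "awalk (head G a) (q @ [a]) (head G a)"
    by (intro awalk_appendI[of _ _ "tail G a"]) (auto simp: awalk_simps)
  then show ?case using q(1) by (auto simp: closed_w_def)
qed

lemma count_list_rotate: "count_list (rotate k xs) x = count_list xs x"
proof -
  have "count_list (rotate k xs) x
      = count_list (take (k mod length xs) xs @ drop (k mod length xs) xs) x"
    unfolding rotate_drop_take count_list_append by simp
  then show ?thesis by simp
qed

lemma eulerian_circuit_rotate:
  assumes "wf_digraph G" "eulerian_circuit G p"
  shows "eulerian_circuit G (rotate k p)"
proof -
  have "count_list (map fst (rotate k p)) = count_list (map fst p)"
    by (simp add: fun_eq_iff count_list_rotate flip: rotate_map)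
  then show ?thesis
    using assms
    by (simp add: eulerian_circuit_def wf_digraph.closed_w_rotate[OF wf_digraph_oriented])
qed

lemma equiv_rotation_rel:
  assumes "wf_digraph G"
  shows "equiv {p. eulerian_circuit G p} (rotation_rel G)"
proof (rule equivI)
  show "sym (rotation_rel G)"
  proof (rule symI)
    fix p q assume pq: "(p, q) \<in> rotation_rel G"
    then obtain k where "q = rotate k p" by (auto simp: rotation_rel_def)
    \<comment> \<open>Reducing \<open>k\<close> below the length keeps the subtraction in the
      inverse rotation from truncating.\<close>
    from this rotate_conv_mod have "q = rotate (k mod length p) p" by (rule trans)
    moreover have "p \<noteq> []"
      using pq wf_digraph_oriented[OF assms]
      by (auto simp: rotation_rel_def eulerian_circuit_def wf_digraph.closed_w_def)
    ultimately have "rotate (length p - k mod length p) q = p"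
      by (simp add: rotate_rotate)
    then show "(q, p) \<in> rotation_rel G"
      using pq by (auto simp: rotation_rel_def) metis
  qed
  show "trans (rotation_rel G)"
    by (rule transI) (auto simp: rotation_rel_def rotate_rotate)
qed (auto simp: rotation_rel_def refl_on_def intro: exI[of _ 0])

lemma finite_eulerian_circuits:
  assumes "fin_digraph G"
  shows "finite {p. eulerian_circuit G p}"
proof -
  interpret fin_digraph G by fact
  have "{p. eulerian_circuit G p} \<subseteq>
      {p. set p \<subseteq> arcs G \<times> UNIV \<and> length p = card (arcs G)}"
    using eulerian_circuit_length_distinct(1,3)[OF assms]
    by (auto simp del: set_map) (metis fst_conv image_eqI set_map)
  then show ?thesis by (rule finite_subset) (intro finite_lists_length_eq, simp)
qed

text \<open>The entries of a circuit are distinct, so rotations by less than its length already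
  differ in their first entry.\<close>

lemma card_rotation_class:
  assumes "fin_digraph G" "eulerian_circuit G p"
  shows "card (rotation_rel G `` {p}) = card (arcs G)"
proof -
  interpret fin_digraph G by fact
  note p = eulerian_circuit_length_distinct[OF assms]
  have "distinct p" using p(2) by (simp add: distinct_map)
  have "p \<noteq> []"
    using assms(2) wf_digraph_oriented[OF wf_digraph]
    by (auto simp: eulerian_circuit_def wf_digraph.closed_w_def)
  have "rotation_rel G `` {p} = (\<lambda>k. rotate k p) ` {..<length p}"
  proof
    show "rotation_rel G `` {p} \<subseteq> (\<lambda>k. rotate k p) ` {..<length p}"
    proof
      fix q assume "q \<in> rotation_rel G `` {p}"
      then obtain k where "q = rotate k p" by (auto simp: rotation_rel_def)
      from this rotate_conv_mod have "q = rotate (k mod length p) p" by (rule trans)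
      then show "q \<in> (\<lambda>k. rotate k p) ` {..<length p}" using \<open>p \<noteq> []\<close> by auto
    qed
  qed (use assms(2) eulerian_circuit_rotate[OF wf_digraph] in \<open>auto simp: rotation_rel_def\<close>)
  moreover have "inj_on (\<lambda>k. rotate k p) {..<length p}"
  proof (rule inj_onI)
    fix k l assume kl: "k \<in> {..<length p}" "l \<in> {..<length p}" "rotate k p = rotate l p"
    then have "p ! k = p ! l"
      using hd_rotate_conv_nth[OF \<open>p \<noteq> []\<close>, of k] hd_rotate_conv_nth[OF \<open>p \<noteq> []\<close>, of l] by simp
    then show "k = l" using kl \<open>distinct p\<close> by (simp add: nth_eq_iff_index_eq)
  qed
  ultimately show ?thesis using p(1) by (simp add: card_image)
qed

lemma card_eulerian_circuits:
  assumes "fin_digraph G"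
  shows "card (arcs G) * ec G = card {p. eulerian_circuit G p}"
proof -
  interpret fin_digraph G by fact
  let ?E = "{p. eulerian_circuit G p}"
  note eq = equiv_rotation_rel[OF wf_digraph]
  have "card (arcs G) * card (?E // rotation_rel G) = card (\<Union>(?E // rotation_rel G))"
  proof (rule card_partition)
    show "finite (\<Union>(?E // rotation_rel G))"
      using finite_eulerian_circuits[OF assms] by (simp add: Union_quotient[OF eq])
    then show "finite (?E // rotation_rel G)" by (rule finite_UnionD)
    show "card c = card (arcs G)" if "c \<in> ?E // rotation_rel G" for c
      using that card_rotation_class[OF assms] by (auto simp: quotient_def)
    show "c1 \<inter> c2 = {}"
      if "c1 \<in> ?E // rotation_rel G" "c2 \<in> ?E // rotation_rel G" "c1 \<noteq> c2" for c1 c2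
      using quotient_disj[OF eq that(1,2)] that(3) by blast
  qed
  then show ?thesis by (simp add: ec_def Union_quotient[OF eq])
qed

section \<open>Recognizing Eulerian circuits by parities outside the tree\<close>

text \<open>A cycle modulo 2 is determined by its coefficients outside \<open>T\<close>, so the
  parities there decide those on \<open>T\<close> as well.\<close>

lemma closed_w_odd_iff_eulerian_circuit:
  assumes "fin_digraph G" "eulerian G" "undirected_spanning_tree T G"
    and p: "wf_digraph.closed_w (oriented G) p" "length p = card (arcs G)"
  shows "(\<forall>e\<in>co_edges G T. odd (count_list (map fst p) e)) \<longleftrightarrow> eulerian_circuit G p"
proof
  interpret fin_digraph G by fact
  interpret O: wf_digraph "oriented G" by (rule wf_digraph_oriented) (rule wf_digraph)
  have closed_even: "boundary G {e. odd (count_list (map fst q) e)} v = 0" if "O.closed_w q" for q v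
    using that boundary_odd_count[OF wf_digraph] by (auto simp: O.closed_w_def)
  have T: "wf_digraph T" "\<nexists>p. undirected_cycle T p" "tail T = tail G" "head T = head G"
    using assms(3) by (auto simp: undirected_spanning_tree_def undirected_tree_def spanning_def
      subgraph_def compatible_def)
  assume odd: "\<forall>e\<in>co_edges G T. odd (count_list (map fst p) e)"
  define F where "F = {e. odd (count_list (map fst p) e)}"
  have sub: "set (map fst p) \<subseteq> arcs G"
    using p(1) by (auto simp: O.closed_w_def O.awalk_def)
  then have "F \<subseteq> arcs G" by (force simp: F_def intro: ccontr count_notin)
  obtain c where c: "eulerian_circuit G c" using assms(2) by (auto simp: eulerian_def)
  \<comment> \<open>For the circuit \<open>c\<close> the edges of odd multiplicity are all the
    edges.\<close>
  have "boundary G (arcs G) v = 0" for v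
    using closed_even[of c v] c odd_count_distinct[of "map fst c"]
      eulerian_circuit_length_distinct[OF assms(1) c]
    by (simp add: eulerian_circuit_def)
  moreover have "boundary G F v = 0" for v
    using closed_even[OF p(1)] by (simp add: F_def)
  ultimately have "boundary G (arcs G - F \<union> (F - arcs G)) v = 0" for v
    using boundary_sym_diff[of "arcs G" F G v] \<open>F \<subseteq> arcs G\<close> by (simp add: finite_subset)
  \<comment> \<open>The symmetric difference is just \<open>arcs G - F\<close>, and \<open>T\<close>
    has the ends of edges from \<open>G\<close>, so acyclicity of \<open>T\<close> becomes
    applicable.\<close>
  then have "boundary T (arcs G - F) v = 0" for v
    using \<open>F \<subseteq> arcs G\<close> T by (simp add: boundary_def Un_absorb2 Diff_eq_empty_iff[THEN iffD2])
  moreover have "arcs G - F \<subseteq> arcs T"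
    using odd by (auto simp: F_def co_edges_def)
  ultimately have "arcs G - F = {}"
    by (intro even_acyclic_empty[OF T(1,2)]) auto
  then have pos: "1 \<le> count_list (map fst p) e" if "e \<in> arcs G" for e
  proof -
    have "odd (count_list (map fst p) e)" using that \<open>arcs G - F = {}\<close> by (auto simp: F_def)
    then show ?thesis by (cases "count_list (map fst p) e") simp_all
  qed
  \<comment> \<open>The multiplicities are at least 1 and sum to the number of edges, so none
    exceeds 1.\<close>
  have "(\<Sum>e\<in>arcs G. 1) = (\<Sum>e\<in>arcs G. count_list (map fst p) e)"
    using sum_count_set[OF sub finite_arcs] p(2) by simp
  then have "1 = count_list (map fst p) e" if "e \<in> arcs G" for e
    by (rule sum_mono_inv) (use pos that in auto)
  then show "eulerian_circuit G p" using p(1) by (simp add: eulerian_circuit_def)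
qed (auto simp: eulerian_circuit_def co_edges_def)

subsection \<open>The character sum\<close>

lemma sign_bit_0 [simp]: "sign_bit 0 = 1"
  by (simp add: sign_bit_def)

text \<open>\<open>sign_bit\<close> is the nontrivial character of the group of order 2.\<close>

lemma sign_bit_add: "sign_bit (x + y) = sign_bit x * sign_bit y"
  by (cases x; cases y) (simp_all add: sign_bit_def)

lemma sign_bit_sum: "sign_bit (sum f S) = (\<Prod>x\<in>S. sign_bit (f x))"
  by (induction S rule: infinite_finite_induct) (simp_all only: sum.infinite prod.infinite sum.empty
      prod.empty sum.insert prod.insert sign_bit_add sign_bit_0 simp_thms)

lemma UNIV_bit: "(UNIV :: bit set) = {0, 1}"
  using bit_not_zero_iff by blast

text \<open>Orthogonality of characters: the sum factors over the coordinates, and each factor is 1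
  plus a power of -1, that is, 2 or 0.\<close>

lemma sum_prod_sign_bit:
  assumes "finite S"
  shows "(\<Sum>\<gamma> | \<forall>e. e \<notin> S \<longrightarrow> \<gamma> e = 0. \<Prod>e\<in>S. sign_bit (\<gamma> e) ^ f e)
    = (if \<forall>e\<in>S. even (f e) then 2 ^ card S else 0)"
proof -
  \<comment> \<open>Chains are 0 outside \<open>S\<close>, while members of \<open>PiE\<close> are
    \<open>undefined\<close> there; the bijection exchanges the two default values.\<close>
  have "(\<Sum>\<gamma> | \<forall>e. e \<notin> S \<longrightarrow> \<gamma> e = 0. \<Prod>e\<in>S. sign_bit (\<gamma> e) ^ f e)
      = (\<Sum>\<gamma>\<in>PiE S (\<lambda>_. UNIV). \<Prod>e\<in>S. sign_bit (\<gamma> e) ^ f e)"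
  proof (rule sum.reindex_bij_witness[where i = "\<lambda>\<gamma> e. if e \<in> S then \<gamma> e else 0"
        and j = "\<lambda>\<gamma>. restrict \<gamma> S"])
    show "restrict (\<lambda>e. if e \<in> S then \<gamma> e else 0) S = \<gamma>"
      if "\<gamma> \<in> PiE S (\<lambda>_. UNIV)" for \<gamma> :: "'a \<Rightarrow> bit"
      using that by (auto simp: restrict_def PiE_def extensional_def)
  qed (auto simp: fun_eq_iff)
  also have "\<dots> = (\<Prod>e\<in>S. \<Sum>c\<in>UNIV. sign_bit c ^ f e)"
    using assms by (intro prod_sum_PiE[symmetric]) (auto simp: UNIV_bit)
  also have "\<dots> = (\<Prod>e\<in>S. if even (f e) then 2 else 0)"
    by (auto simp: UNIV_bit sign_bit_def intro!: prod.cong)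
  also have "\<dots> = (if \<forall>e\<in>S. even (f e) then 2 ^ card S else 0)"
    using assms by (auto intro!: prod_zero)
  finally show ?thesis .
qed

text \<open>The signs along the walk are grouped by underlying edge; edges outside \<open>S\<close>
  have sign 1.\<close>

lemma prod_list_\<chi>:
  assumes "finite S" "\<And>e. e \<notin> S \<Longrightarrow> \<gamma> e = 0"
  shows "prod_list (map (\<chi> \<gamma>) p) = (\<Prod>e\<in>S. sign_bit (\<gamma> e) ^ count_list (map fst p) e)"
proof (induction p)
  case (Cons a p)
  \<comment> \<open>Written as a product over \<open>S\<close> with at most one nontrivial factor,
    the new sign merges with the induction hypothesis.\<close>
  have "\<chi> \<gamma> a = (\<Prod>e\<in>S. if e = fst a then sign_bit (\<gamma> e) else 1)"
    using assms by (auto simp: \<chi>_def sign_bit_def)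
  then show ?case
    by (simp add: Cons flip: prod.distrib) (auto intro!: prod.cong)
qed simp

lemma M2_eq: "M2 G T = {\<gamma>. \<forall>e. e \<notin> co_edges G T \<longrightarrow> \<gamma> e = 0}"
  by (auto simp: M2_def C1_def co_edges_def)

text \<open>The sign of \<open>\<sigma>\<close> raises every exponent by one, so that character
  orthogonality selects odd instead of even multiplicities.\<close>

lemma sum_M2_walks:
  assumes "finite (arcs G)" "finite P"
  shows "(\<Sum>\<gamma>\<in>M2 G T. sign_bit (\<sigma> G T \<gamma>) * (\<Sum>p\<in>P. prod_list (map (\<chi> \<gamma>) p)))
    = 2 ^ card (co_edges G T)
      * real (card {p \<in> P. \<forall>e\<in>co_edges G T. odd (count_list (map fst p) e)})"
proof -
  let ?S = "co_edges G T"
  have S: "finite ?S" using assms(1) by (simp add: co_edges_def)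
  have "(\<Sum>\<gamma>\<in>M2 G T. sign_bit (\<sigma> G T \<gamma>) * (\<Sum>p\<in>P. prod_list (map (\<chi> \<gamma>) p)))
      = (\<Sum>p\<in>P. \<Sum>\<gamma>\<in>M2 G T. sign_bit (\<sigma> G T \<gamma>) * prod_list (map (\<chi> \<gamma>) p))"
    unfolding sum_distrib_left by (rule sum.swap)
  also have "\<dots> = (\<Sum>p\<in>P. \<Sum>\<gamma>\<in>M2 G T. \<Prod>e\<in>?S. sign_bit (\<gamma> e) ^ Suc (count_list (map fst p) e))"
  proof (intro sum.cong refl)
    fix \<gamma> p assume "\<gamma> \<in> M2 G T"
    then have "prod_list (map (\<chi> \<gamma>) p) = (\<Prod>e\<in>?S. sign_bit (\<gamma> e) ^ count_list (map fst p) e)"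
      by (intro prod_list_\<chi>[OF S]) (simp add: M2_eq)
    then show "sign_bit (\<sigma> G T \<gamma>) * prod_list (map (\<chi> \<gamma>) p)
        = (\<Prod>e\<in>?S. sign_bit (\<gamma> e) ^ Suc (count_list (map fst p) e))"
      by (simp add: \<sigma>_def sign_bit_sum prod.distrib)
  qed
  also have "\<dots> = (\<Sum>p\<in>P. if \<forall>e\<in>?S. odd (count_list (map fst p) e) then 2 ^ card ?S else 0)"
    unfolding M2_eq sum_prod_sign_bit[OF S] by simp
  also have "\<dots> = 2 ^ card ?S * real (card {p \<in> P. \<forall>e\<in>?S. odd (count_list (map fst p) e)})"
    using assms(2) by (simp add: sum.If_cases Collect_conj_eq Int_commute)
  finally show ?thesis .
qed

subsection \<open>Traces as sums over closed walks\<close>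

text \<open>
  An edge \<open>a\<close> from \<open>x\<close> to \<open>y\<close> must determine \<open>x\<close> (as \<open>t a\<close>): this keeps the walks passing
  through different last intermediate indices disjoint.
\<close>
lemma pow_mat_entry_walks:
  fixes w :: "'a \<Rightarrow> 'b :: comm_semiring_1"
    and P :: "nat \<Rightarrow> 'i \<Rightarrow> 'i \<Rightarrow> 'a list set"
  defines "M \<equiv> \<lambda>xs S. mat (length xs) (length xs) (\<lambda>(i, j). \<Sum>a\<in>S (xs ! i) (xs ! j). w a)"
  assumes "distinct xs" "i < length xs" "j < length xs"
    and finite_S: "\<And>x y. x \<in> set xs \<Longrightarrow> y \<in> set xs \<Longrightarrow> finite (S x y)"
    and source: "\<And>a x y. x \<in> set xs \<Longrightarrow> y \<in> set xs \<Longrightarrow> a \<in> S x y \<Longrightarrow> t a = x"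
    and P_0: "\<And>x y. x \<in> set xs \<Longrightarrow> y \<in> set xs \<Longrightarrow> P 0 x y = (if x = y then {[]} else {})"
    and P_Suc: "\<And>k x y. x \<in> set xs \<Longrightarrow> y \<in> set xs \<Longrightarrow>
      P (Suc k) x y = {p @ [a] |p a z. z \<in> set xs \<and> p \<in> P k x z \<and> a \<in> S z y}"
  shows "finite (P k (xs ! i) (xs ! j)) \<and>
    (M xs S ^\<^sub>m k) $$ (i, j) = (\<Sum>p\<in>P k (xs ! i) (xs ! j). prod_list (map w p))"
  using assms(4)
proof (induction k arbitrary: j)
  case 0
  then show ?case
    using assms(2,3) P_0 by (auto simp: M_def nth_eq_iff_index_eq)
next
  case (Suc k)
  let ?x = "xs ! i" and ?y = "xs ! j"
  \<comment> \<open>\<open>Q z\<close> collects the walks whose last step is taken from the index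
    \<open>z\<close>.\<close>
  define Q where "Q z = (\<lambda>(p, a). p @ [a]) ` (P k ?x z \<times> S z ?y)" for z
  have eq: "P (Suc k) ?x ?y = (\<Union>l<length xs. Q (xs ! l))"
    using P_Suc[of ?x ?y k] assms(3) Suc.prems
    by (auto simp: Q_def set_conv_nth image_iff) blast+
  have finQ: "finite (Q (xs ! l))" if "l < length xs" for l
    using Suc.IH[OF that] finite_S[of "xs ! l" ?y] that Suc.prems by (simp add: Q_def)
  have disj: "Q (xs ! l) \<inter> Q (xs ! l') = {}"
    if "l < length xs" "l' < length xs" "l \<noteq> l'" for l l'
  proof -
    have "xs ! l \<noteq> xs ! l'" using that assms(2) by (simp add: nth_eq_iff_index_eq)
    then show ?thesis
      using source[of "xs ! l" ?y] source[of "xs ! l'" ?y] that Suc.prems by (fastforce simp: Q_def)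
  qed
  have "(M xs S ^\<^sub>m Suc k) $$ (i, j)
      = (\<Sum>l<length xs. (M xs S ^\<^sub>m k) $$ (i, l) * M xs S $$ (l, j))"
    using Suc.prems assms(3)
    by (simp add: M_def scalar_prod_def lessThan_atLeast0)
  also have "\<dots> = (\<Sum>l<length xs. \<Sum>p\<in>Q (xs ! l). prod_list (map w p))"
  proof (rule sum.cong)
    fix l assume "l \<in> {..<length xs}"
    then have l: "l < length xs" by simp
    have "(M xs S ^\<^sub>m k) $$ (i, l) * M xs S $$ (l, j)
        = (\<Sum>p\<in>P k ?x (xs ! l). prod_list (map w p)) * (\<Sum>a\<in>S (xs ! l) ?y. w a)"
      using Suc.IH[OF l] l Suc.prems by (simp add: M_def)
    also have "\<dots> = (\<Sum>(p, a)\<in>P k ?x (xs ! l) \<times> S (xs ! l) ?y. prod_list (map w (p @ [a])))"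
      by (simp add: sum_product sum.cartesian_product)
    also have "\<dots> = (\<Sum>p\<in>Q (xs ! l). prod_list (map w p))"
      unfolding Q_def by (subst sum.reindex) (auto simp: inj_on_def intro: sum.cong)
    finally show "(M xs S ^\<^sub>m k) $$ (i, l) * M xs S $$ (l, j)
        = (\<Sum>p\<in>Q (xs ! l). prod_list (map w p))" .
  qed simp
  also have "\<dots> = (\<Sum>p\<in>P (Suc k) ?x ?y. prod_list (map w p))"
    unfolding eq using finQ disj by (intro sum.UNION_disjoint[symmetric]) auto
  finally show ?case using finQ eq by simp
qed

text \<open>The function \<open>b\<close> recovers the base of a closed walk, making the diagonal
  sets disjoint. The empty walk has no unique base, whence \<open>k > 0\<close> in the instances
  below.\<close>

lemma trace_pow_mat_walks:
  fixes w :: "'a \<Rightarrow> 'b :: comm_semiring_1"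
    and P :: "nat \<Rightarrow> 'i \<Rightarrow> 'i \<Rightarrow> 'a list set"
  assumes "distinct xs"
    and finite_S: "\<And>x y. x \<in> set xs \<Longrightarrow> y \<in> set xs \<Longrightarrow> finite (S x y)"
    and source: "\<And>a x y. x \<in> set xs \<Longrightarrow> y \<in> set xs \<Longrightarrow> a \<in> S x y \<Longrightarrow> t a = x"
    and P_0: "\<And>x y. x \<in> set xs \<Longrightarrow> y \<in> set xs \<Longrightarrow> P 0 x y = (if x = y then {[]} else {})"
    and P_Suc: "\<And>k x y. x \<in> set xs \<Longrightarrow> y \<in> set xs \<Longrightarrow>
      P (Suc k) x y = {p @ [a] |p a z. z \<in> set xs \<and> p \<in> P k x z \<and> a \<in> S z y}"
    and base: "\<And>p x. x \<in> set xs \<Longrightarrow> p \<in> P k x x \<Longrightarrow> b p = x"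
  shows "finite (\<Union>x\<in>set xs. P k x x)"
    and "mat_trace (mat (length xs) (length xs) (\<lambda>(i, j). \<Sum>a\<in>S (xs ! i) (xs ! j). w a) ^\<^sub>m k)
      = (\<Sum>p\<in>(\<Union>x\<in>set xs. P k x x). prod_list (map w p))"
proof -
  let ?M = "mat (length xs) (length xs) (\<lambda>(i, j). \<Sum>a\<in>S (xs ! i) (xs ! j). w a)"
  have *: "finite (P k (xs ! i) (xs ! i)) \<and>
      (?M ^\<^sub>m k) $$ (i, i) = (\<Sum>p\<in>P k (xs ! i) (xs ! i). prod_list (map w p))"
    if "i < length xs" for i
    by (rule pow_mat_entry_walks[OF assms(1) that that finite_S source P_0 P_Suc])
  then have fin: "finite (P k x x)" if "x \<in> set xs" for x
    using that by (auto simp: in_set_conv_nth)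
  then show "finite (\<Union>x\<in>set xs. P k x x)" by blast
  have "mat_trace (?M ^\<^sub>m k) = (\<Sum>i<length xs. \<Sum>p\<in>P k (xs ! i) (xs ! i). prod_list (map w p))"
    using * by (simp add: mat_trace_def)
  also have "\<dots> = (\<Sum>x\<in>set xs. \<Sum>p\<in>P k x x. prod_list (map w p))"
    using assms(1) by (intro sum.reindex_bij_betw[OF bij_betw_nth]) auto
  also have "\<dots> = (\<Sum>p\<in>(\<Union>x\<in>set xs. P k x x). prod_list (map w p))"
    using fin base by (intro sum.UNION_disjoint[symmetric]) (auto, metis)
  finally show "mat_trace (?M ^\<^sub>m k) = (\<Sum>p\<in>(\<Union>x\<in>set xs. P k x x). prod_list (map w p))" .
qed

text \<open>The indices are vertices; a step is determined to leave its tail, and a closed walk has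
  as base the tail of its first edge.\<close>

lemma trace_vertex_adj:
  assumes "fin_digraph G" "distinct vs" "set vs = verts G" "k > 0"
  defines "P \<equiv> {p. wf_digraph.closed_w (oriented G) p \<and> length p = k}"
  shows "finite P"
    and "mat_trace (twisted_vertex_adj G vs \<gamma> ^\<^sub>m k) = (\<Sum>p\<in>P. prod_list (map (\<chi> \<gamma>) p))"
proof -
  interpret fin_digraph G by fact
  interpret O: wf_digraph "oriented G" by (rule wf_digraph_oriented) (rule wf_digraph)
  define S where "S u v = {a \<in> arcs (oriented G). tail (oriented G) a = u \<and> head (oriented G) a = v}"
    for u v
  define W where "W l u v = {p. length p = l \<and> O.awalk u p v}" for l u v
  have finS: "finite (S u v)" for u v
    by (rule finite_subset[of _ "arcs G \<times> UNIV"]) (auto simp: S_def)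
  have W_0: "W 0 u v = (if u = v then {[]} else {})" if "u \<in> set vs" for u v
    using that assms(3) by (auto simp: W_def O.awalk_Nil_iff)
  have W_Suc: "W (Suc l) u v = {p @ [a] |p a z. z \<in> set vs \<and> p \<in> W l u z \<and> a \<in> S z v}" for l u v
  proof (intro equalityI subsetI)
    fix q assume "q \<in> W (Suc l) u v"
    then obtain p a where q: "q = p @ [a]" "length p = l" "O.awalk u (p @ [a]) v"
      by (auto simp: W_def length_Suc_conv_rev)
    then have *: "O.awalk u p (tail (oriented G) a)" and "a \<in> S (tail (oriented G) a) v"
      by (auto simp: O.awalk_simps S_def simp del: oriented_simps)
    moreover have "tail (oriented G) a \<in> set vs"
      using O.awalk_last_in_verts[OF *] by (simp add: assms(3))
    ultimately show "q \<in> {p @ [a] |p a z. z \<in> set vs \<and> p \<in> W l u z \<and> a \<in> S z v}"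
      using q(1,2) unfolding W_def by blast
  next
    fix q assume "q \<in> {p @ [a] |p a z. z \<in> set vs \<and> p \<in> W l u z \<and> a \<in> S z v}"
    then obtain p a z where q: "q = p @ [a]" "p \<in> W l u z" "a \<in> S z v" by blast
    then have "O.awalk z [a] v"
      using O.arc_implies_awalk[of a] by (auto simp: S_def simp del: oriented_simps)
    then have "O.awalk u (p @ [a]) v"
      using q(2) O.awalk_appendI by (simp only: W_def) blast
    then show "q \<in> W (Suc l) u v" using q by (simp add: W_def)
  qed
  have base: "tail (oriented G) (hd p) = u" if "p \<in> W k u u" for p u
    using that assms(4) by (cases p) (auto simp: W_def O.awalk_simps)
  have P: "P = (\<Union>u\<in>set vs. W k u u)"
    using assms(3,4) O.awalk_hd_in_verts by (auto simp: P_def W_def O.closed_w_def)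
  have adj: "twisted_vertex_adj G vs \<gamma>
      = mat (length vs) (length vs) (\<lambda>(i, j). \<Sum>a\<in>S (vs ! i) (vs ! j). \<chi> \<gamma> a)"
    by (simp add: twisted_vertex_adj_def S_def)
  note * = trace_pow_mat_walks[of vs S "tail (oriented G)" W k, OF assms(2) finS _ W_0 W_Suc base]
  show "finite P" unfolding P by (rule *) (auto simp: S_def)
  show "mat_trace (twisted_vertex_adj G vs \<gamma> ^\<^sub>m k) = (\<Sum>p\<in>P. prod_list (map (\<chi> \<gamma>) p))"
    unfolding P adj by (rule *) (auto simp: S_def)
qed

text \<open>The indices are oriented edges, and a step from \<open>a\<close> to \<open>b\<close>
  records \<open>a\<close>, whose sign the matrix entry carries.\<close>

lemma trace_edge_adj:
  assumes "fin_digraph G" "distinct as" "set as = arcs (oriented G)" "k > 0"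
  defines "P \<equiv> {p. wf_digraph.closed_w (oriented G) p \<and> length p = k \<and>
    successively (\<lambda>a b. b \<noteq> inv_edge a) (p @ [hd p])}"
  shows "finite P"
    and "mat_trace (twisted_edge_adj G as \<gamma> ^\<^sub>m k) = (\<Sum>p\<in>P. prod_list (map (\<chi> \<gamma>) p))"
proof -
  interpret fin_digraph G by fact
  interpret O: wf_digraph "oriented G" by (rule wf_digraph_oriented) (rule wf_digraph)
  let ?t = "tail (oriented G)" and ?h = "head (oriented G)"
  define S where "S a b = (if feeds_into G a b then {a} else {})" for a b
  \<comment> \<open>The final index \<open>b\<close> is not recorded in \<open>p\<close> but
    constrains its last step. On the diagonal it is the first edge, so backtracking is also excluded
    where the walk closes up.\<close>
  define W where "W l a b = {p. length p = l \<and> O.awalk (?t a) p (?t b) \<and>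
    hd (p @ [b]) = a \<and> successively (\<lambda>a b. b \<noteq> inv_edge a) (p @ [b])}" for l a b
  have W_0: "W 0 a b = (if a = b then {[]} else {})" if "a \<in> set as" for a b
    using that assms(3) by (auto simp: W_def O.awalk_Nil_iff simp del: oriented_simps)
  have W_Suc: "W (Suc l) a b = {p @ [c] |p c z. z \<in> set as \<and> p \<in> W l a z \<and> c \<in> S z b}" for l a b
  proof (intro equalityI subsetI)
    fix q assume q_W: "q \<in> W (Suc l) a b"
    then obtain p c where "q = p @ [c]" "length p = l"
      by (auto simp: W_def length_Suc_conv_rev)
    moreover have "hd ((p @ [c]) @ [b]) = hd (p @ [c])" by (cases p) simp_all
    ultimately have q: "q = p @ [c]" "length p = l" "O.awalk (?t a) (p @ [c]) (?t b)"
        "hd (p @ [c]) = a" "successively (\<lambda>a b. b \<noteq> inv_edge a) ((p @ [c]) @ [b])"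
      using q_W by (simp_all only: W_def mem_Collect_eq)
    then have "O.awalk (?t a) p (?t c)" "c \<in> set as" "?h c = ?t b"
      by (auto simp: O.awalk_simps assms(3) simp del: oriented_simps)
    moreover have "successively (\<lambda>a b. b \<noteq> inv_edge a) (p @ [c])" "b \<noteq> inv_edge c"
      using q(5) unfolding successively_append_iff[of _ "p @ [c]"] by auto
    ultimately have "c \<in> set as" "p \<in> W l a c" "c \<in> S c b"
      using q(2,4) by (simp_all add: W_def S_def feeds_into_def)
    then show "q \<in> {p @ [c] |p c z. z \<in> set as \<and> p \<in> W l a z \<and> c \<in> S z b}"
      using q(1) by blast
  next
    fix q assume "q \<in> {p @ [c] |p c z. z \<in> set as \<and> p \<in> W l a z \<and> c \<in> S z b}"
    then obtain p c where q: "q = p @ [c]" "c \<in> set as" "p \<in> W l a c" "feeds_into G c b"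
      by (auto simp: S_def split: if_splits)
    then have "O.awalk (?t c) [c] (?t b)"
      using O.arc_implies_awalk[of c] assms(3) by (simp add: feeds_into_def del: oriented_simps)
    then have "O.awalk (?t a) (p @ [c]) (?t b)"
      using q(3) O.awalk_appendI by (simp only: W_def) blast
    moreover have "successively (\<lambda>a b. b \<noteq> inv_edge a) ((p @ [c]) @ [b])"
      using q(3,4) unfolding successively_append_iff[of _ "p @ [c]"]
      by (simp add: W_def feeds_into_def)
    ultimately show "q \<in> W (Suc l) a b" using q(1,3) by (simp add: W_def hd_append)
  qed
  have base: "hd p = a" if "p \<in> W k a a" for p a
    using that assms(4) by (cases p) (auto simp: W_def)
  have P: "P = (\<Union>a\<in>set as. W k a a)"
  proof (intro equalityI subsetI)
    fix p assume p: "p \<in> P"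
    then obtain a q where "p = a # q" by (cases p) (auto simp: P_def O.closed_w_def)
    then have "a \<in> set as" "p \<in> W k a a"
      using p by (auto simp: P_def O.closed_w_def W_def O.awalk_Cons_iff assms(3) simp del: oriented_simps)
    then show "p \<in> (\<Union>a\<in>set as. W k a a)" by blast
  next
    fix p assume "p \<in> (\<Union>a\<in>set as. W k a a)"
    then obtain a where "p \<in> W k a a" by blast
    with base[OF this] show "p \<in> P" using assms(4) by (auto simp: P_def W_def O.closed_w_def)
  qed
  have adj: "twisted_edge_adj G as \<gamma>
      = mat (length as) (length as) (\<lambda>(i, j). \<Sum>a\<in>S (as ! i) (as ! j). \<chi> \<gamma> a)"
    by (auto simp: twisted_edge_adj_def S_def intro!: cong_mat)
  have finS: "finite (S a b)" for a b by (simp add: S_def)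
  have source: "c = a" if "c \<in> S a b" for a b c
    using that by (simp add: S_def split: if_splits)
  note * = trace_pow_mat_walks[of as S id W k, OF assms(2) finS _ W_0 W_Suc base]
  show "finite P" unfolding P by (rule *) (auto dest: source)
  show "mat_trace (twisted_edge_adj G as \<gamma> ^\<^sub>m k) = (\<Sum>p\<in>P. prod_list (map (\<chi> \<gamma>) p))"
    unfolding P adj by (rule *) (auto dest: source)
qed

section \<open>Assembling the formula\<close>

text \<open>An edge and its inverse share the underlying edge, which a circuit uses once. Hence the
  edge matrix loses no Eulerian circuit.\<close>

lemma eulerian_circuit_no_backtrack:
  fixes G :: "('v,'e) pre_digraph"
  assumes "fin_digraph G" "eulerian_circuit G p"
  shows "successively (\<lambda>a b. b \<noteq> inv_edge a) (p @ [hd p])"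
proof -
  have dist: "distinct (map fst p)"
    using eulerian_circuit_length_distinct[OF assms] by simp
  have inv: "fst (inv_edge a) = fst a" "inv_edge a \<noteq> a" for a :: "'e \<times> bool"
    by (cases a; simp)+
  have "successively (\<lambda>a b. b \<noteq> inv_edge a) p"
    unfolding successively_conv_nth
  proof (intro allI impI)
    fix i assume "Suc i < length p"
    then have "map fst p ! i \<noteq> map fst p ! Suc i"
      using dist by (subst nth_eq_iff_index_eq) auto
    then show "p ! Suc i \<noteq> inv_edge (p ! i)"
      using \<open>Suc i < length p\<close> by (auto simp: inv(1))
  qed
  \<comment> \<open>For a circuit of length one, a single loop, this compares an oriented edge with
    its own inverse, which is a different one.\<close>
  moreover have "hd p \<noteq> inv_edge (last p)" if "p \<noteq> []"
  proof (cases "tl p = []")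
    case True
    then have "hd p = last p" using that by (cases p) auto
    then show ?thesis using inv(2) by metis
  next
    case False
    then have "last p \<in> set (tl p)" using last_in_set[of "tl p"] by (simp add: last_tl)
    moreover have "fst (hd p) \<notin> fst ` set (tl p)" using dist that by (cases p) auto
    ultimately show ?thesis using inv(1) by (metis image_eqI)
  qed
  ultimately show ?thesis by (auto simp: successively_append_iff)
qed

theorem theorem1p1:
  fixes G T :: "('v,'e) pre_digraph"
    and vs :: "'v list"
    and as :: "('e \<times> bool) list"
  assumes "fin_digraph G"
    and "Digraph_Component.connected G"
    and "eulerian G"
    and "undirected_spanning_tree T G"
    and "distinct vs" and "set vs = verts G"
    and "distinct as" and "set as = arcs (oriented G)"
  shows "real (ec G) =
           1 / (real (card (arcs G)) * 2 ^ genus G) *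
             (\<Sum>\<gamma>\<in>M2 G T. sign_bit (\<sigma> G T \<gamma>) *
                mat_trace (twisted_edge_adj G as \<gamma> ^\<^sub>m card (arcs G)))
       \<and> 1 / (real (card (arcs G)) * 2 ^ genus G) *
             (\<Sum>\<gamma>\<in>M2 G T. sign_bit (\<sigma> G T \<gamma>) *
                mat_trace (twisted_edge_adj G as \<gamma> ^\<^sub>m card (arcs G))) =
         1 / (real (card (arcs G)) * 2 ^ genus G) *
             (\<Sum>\<gamma>\<in>M2 G T. sign_bit (\<sigma> G T \<gamma>) *
                mat_trace (twisted_vertex_adj G vs \<gamma> ^\<^sub>m card (arcs G)))"
proof -
  interpret fin_digraph G by fact
  interpret O: wf_digraph "oriented G" by (rule wf_digraph_oriented) (rule wf_digraph)
  let ?m = "card (arcs G)"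
  let ?odd = "\<lambda>p. \<forall>e\<in>co_edges G T. odd (count_list (map fst p) e)"
  define A where "A = {p. O.closed_w p \<and> length p = ?m}"
  define W where "W = {p. O.closed_w p \<and> length p = ?m \<and>
    successively (\<lambda>a b. b \<noteq> inv_edge a) (p @ [hd p])}"
  obtain c where c: "eulerian_circuit G c" using assms(3) by (auto simp: eulerian_def)
  then have m: "?m > 0"
    using eulerian_circuit_length_distinct(1)[OF assms(1) c]
    by (auto simp: eulerian_circuit_def O.closed_w_def)
  note circuit = closed_w_odd_iff_eulerian_circuit[OF assms(1,3,4)]
  \<comment> \<open>The parity condition cuts both sets of walks down to the same Eulerian circuits,
    so both character sums take the same value.\<close>
  have A: "{p \<in> A. ?odd p} = {p. eulerian_circuit G p}"
    using circuit eulerian_circuit_length_distinct(1)[OF assms(1)]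
    by (auto simp: A_def eulerian_circuit_def)
  have W: "{p \<in> W. ?odd p} = {p. eulerian_circuit G p}"
    using circuit eulerian_circuit_length_distinct(1)[OF assms(1)]
      eulerian_circuit_no_backtrack[OF assms(1)]
    by (auto simp: W_def eulerian_circuit_def)
  have count: "2 ^ card (co_edges G T) * real (card {p. eulerian_circuit G p})
      = real ?m * 2 ^ genus G * real (ec G)"
    unfolding card_co_edges[OF assms(1,4)] card_eulerian_circuits[OF assms(1), symmetric] by simp
  have "(\<Sum>\<gamma>\<in>M2 G T. sign_bit (\<sigma> G T \<gamma>) * mat_trace (twisted_vertex_adj G vs \<gamma> ^\<^sub>m ?m))
      = real ?m * 2 ^ genus G * real (ec G)"
    unfolding trace_vertex_adj(2)[OF assms(1,5,6) m]
    using sum_M2_walks[OF finite_arcs trace_vertex_adj(1)[OF assms(1,5,6) m]] A count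
    by (simp add: A_def)
  moreover have "(\<Sum>\<gamma>\<in>M2 G T. sign_bit (\<sigma> G T \<gamma>) * mat_trace (twisted_edge_adj G as \<gamma> ^\<^sub>m ?m))
      = real ?m * 2 ^ genus G * real (ec G)"
    unfolding trace_edge_adj(2)[OF assms(1,7,8) m]
    using sum_M2_walks[OF finite_arcs trace_edge_adj(1)[OF assms(1,7,8) m]] W count
    by (simp add: W_def)
  moreover have "arcs G \<noteq> {}" using m by auto
  ultimately show ?thesis by (simp add: field_simps)
qed

end
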